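(* Let $\Gamma$ be a finite nonempty family of objects on a finite unweighted graph $G=(V,E)$, with usage matrix $\mathcal{N}$. Then $$\operatorname{Mod}_2(\Gamma)=\left(\min_{\mu\in\mathcal{P}(\Gamma)}\mu^T\mathcal{N}\mathcal{N}^T\mu\right)^{-1}.$$ Moreover, any optimal $\mu^*$ (i.e. any minimizer of $\mu^T\mathcal{N}\mathcal{N}^T\mu$ over $\mathcal{P}(\Gamma)$) is related to the extremal density $\rho^*$ for $\operatorname{Mod}_2(\Gamma)$ by $$\frac{\rho^*(e)}{\operatorname{Mod}_2(\Gamma)}=\left(\mathcal{N}^T\mu^*\right)(e)\qquad\forall e\in E.$$
   Context: $G=(V,E)$ is a finite graph, unweighted meaning all edge weights equal $1$. A family of objects $\Gamma$ is a set together with a usage matrix $\mathcal{N}=[\mathcal{N}(\gamma,e)]_{\gamma\in\Gamma,e\in E}$ with entries $\mathcal{N}(\gamma,e)\ge 0$, such that every $\gamma\in\Gamma$ has $\mathcal{N}(\gamma,e)>0$ for at least one $e\in E$. The admissible set is $\operatorname{Adm}(\Gamma)=\{\rho\in\mathbb{R}_{\ge0}^E:\ \sum_{e\in E}\mathcal{N}(\gamma,e)\rho(e)\ge 1\ \forall\gamma\in\Gamma\}$, and $$\operatorname{Mod}_2(\Gamma)=\inf_{\rho\in\operatorname{Adm}(\Gamma)}\sum_{e\in E}\rho(e)^2 ;$$ a unique minimizer $\rho^*$, called the extremal density, exists. $\mathcal{P}(\Gamma)=\{\mu\in\mathbb{R}_{\ge0}^\Gamma:\ \sum_{\gamma\in\Gamma}\mu(\gamma)=1\}$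 is the set of probability mass functions on $\Gamma$, viewed as column vectors. *)

theory Defs
  imports "HOL-Analysis.Analysis"
begin

text \<open>
  Loops and parallel edges are allowed.  A simple graph whose edges are two-element vertex sets is
  the case where \<open>ends\<close> is the identity; a directed graph is covered by letting \<open>ends\<close> forget the
  orientation, which plays no role below.
\<close>

locale finite_graph =
  fixes V :: "'v set" and E :: "'e set" and ends :: "'e \<Rightarrow> 'v set"
  assumes finite_V: "finite V"
    and finite_E: "finite E"
    and ends_subset: "e \<in> E \<Longrightarrow> ends e \<subseteq> V"
    and card_ends: "e \<in> E \<Longrightarrow> card (ends e) = 1 \<or> card (ends e) = 2"

text \<open>
  Vectors indexed by a set are functions that are extensional on it (\<open>PiE\<close>), so that a vector
  with index set \<open>E\<close> is determined by its values on \<open>E\<close> and uniqueness of minimizers is plain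
  equality.  Matrices are curried functions that are only evaluated on \<open>\<Gamma>\<close> and \<open>E\<close>.
\<close>

locale object_family = finite_graph V E ends
  for V :: "'v set" and E :: "'e set" and ends :: "'e \<Rightarrow> 'v set" +
  fixes \<Gamma> :: "'g set" and N :: "'g \<Rightarrow> 'e \<Rightarrow> real"
  assumes usage_nonneg: "\<gamma> \<in> \<Gamma> \<Longrightarrow> e \<in> E \<Longrightarrow> 0 \<le> N \<gamma> e"
    and usage_pos: "\<gamma> \<in> \<Gamma> \<Longrightarrow> \<exists>e\<in>E. 0 < N \<gamma> e"

definition usage_mult :: "'e set \<Rightarrow> ('g \<Rightarrow> 'e \<Rightarrow> real) \<Rightarrow> ('e \<Rightarrow> real) \<Rightarrow> 'g \<Rightarrow> real" where
  "usage_mult E N \<rho> \<gamma> = (\<Sum>e\<in>E. N \<gamma> e * \<rho> e)"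

definition usage_transpose_mult ::
    "'g set \<Rightarrow> ('g \<Rightarrow> 'e \<Rightarrow> real) \<Rightarrow> ('g \<Rightarrow> real) \<Rightarrow> 'e \<Rightarrow> real" where
  "usage_transpose_mult \<Gamma> N \<mu> e = (\<Sum>\<gamma>\<in>\<Gamma>. N \<gamma> e * \<mu> \<gamma>)"

definition Adm :: "'e set \<Rightarrow> 'g set \<Rightarrow> ('g \<Rightarrow> 'e \<Rightarrow> real) \<Rightarrow> ('e \<Rightarrow> real) set" where
  "Adm E \<Gamma> N = {\<rho> \<in> E \<rightarrow>\<^sub>E {0..}. \<forall>\<gamma>\<in>\<Gamma>. 1 \<le> usage_mult E N \<rho> \<gamma>}"

definition energy2 :: "'e set \<Rightarrow> ('e \<Rightarrow> real) \<Rightarrow> real" where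
  "energy2 E \<rho> = (\<Sum>e\<in>E. (\<rho> e)\<^sup>2)"

text \<open>
  The infimum is taken in the reals, which is meaningful when \<open>Adm E \<Gamma> N\<close> is nonempty; this always
  holds for finite \<open>\<Gamma>\<close> (see \<open>Adm_nonempty\<close> below).
\<close>

definition Mod2 :: "'e set \<Rightarrow> 'g set \<Rightarrow> ('g \<Rightarrow> 'e \<Rightarrow> real) \<Rightarrow> real" where
  "Mod2 E \<Gamma> N = (INF \<rho>\<in>Adm E \<Gamma> N. energy2 E \<rho>)"

definition extremal_density :: "'e set \<Rightarrow> 'g set \<Rightarrow> ('g \<Rightarrow> 'e \<Rightarrow> real) \<Rightarrow> 'e \<Rightarrow> real" where
  "extremal_density E \<Gamma> N = (THE \<rho>. is_arg_min (energy2 E) (\<lambda>\<rho>. \<rho> \<in> Adm E \<Gamma> N) \<rho>)"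

definition prob_mass_functions :: "'g set \<Rightarrow> ('g \<Rightarrow> real) set" where
  "prob_mass_functions \<Gamma> = {\<mu> \<in> \<Gamma> \<rightarrow>\<^sub>E {0..}. (\<Sum>\<gamma>\<in>\<Gamma>. \<mu> \<gamma>) = 1}"

text \<open>The quadratic form \<open>\<mu>\<^sup>T N N\<^sup>T \<mu>\<close>.\<close>

definition overlap_form :: "'e set \<Rightarrow> 'g set \<Rightarrow> ('g \<Rightarrow> 'e \<Rightarrow> real) \<Rightarrow> ('g \<Rightarrow> real) \<Rightarrow> real" where
  "overlap_form E \<Gamma> N \<mu> = (\<Sum>\<gamma>\<in>\<Gamma>. \<mu> \<gamma> * usage_mult E N (usage_transpose_mult \<Gamma> N \<mu>) \<gamma>)"

definition optimal_pmf :: "'e set \<Rightarrow> 'g set \<Rightarrow> ('g \<Rightarrow> 'e \<Rightarrow> real) \<Rightarrow> ('g \<Rightarrow> real) \<Rightarrow> bool" where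
  "optimal_pmf E \<Gamma> N \<mu> \<longleftrightarrow>
     is_arg_min (overlap_form E \<Gamma> N) (\<lambda>\<mu>. \<mu> \<in> prob_mass_functions \<Gamma>) \<mu>"


text \<open>The definite description in \<open>extremal_density\<close> is justified by the following facts.\<close>

context object_family
begin

lemma Adm_nonempty:
  assumes "finite \<Gamma>"
  shows "Adm E \<Gamma> N \<noteq> {}"
proof -
  have pos: "0 < (\<Sum>e\<in>E. N \<gamma> e)" if "\<gamma> \<in> \<Gamma>" for \<gamma>
    using usage_pos[OF that] usage_nonneg[OF that] finite_E
    by (metis sum_pos2)
  define c where "c = (\<Sum>\<gamma>\<in>\<Gamma>. inverse (\<Sum>e\<in>E. N \<gamma> e))"
  have c0: "0 \<le> c" unfolding c_def by (intro sum_nonneg) (simp add: less_imp_le pos)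
  have "1 \<le> usage_mult E N (\<lambda>e\<in>E. c) \<gamma>" if g: "\<gamma> \<in> \<Gamma>" for \<gamma>
  proof -
    have "inverse (\<Sum>e\<in>E. N \<gamma> e) \<le> c"
      unfolding c_def
      by (rule member_le_sum[OF g, where f = "\<lambda>\<gamma>. inverse (\<Sum>e\<in>E. N \<gamma> e)"])
        (auto simp: assms less_imp_le pos)
    then have "1 \<le> (\<Sum>e\<in>E. N \<gamma> e) * c"
      using pos[OF g] by (simp add: field_simps)
    then show ?thesis by (simp add: usage_mult_def sum_distrib_right)
  qed
  then have "(\<lambda>e\<in>E. c) \<in> Adm E \<Gamma> N" using c0 by (auto simp: Adm_def)
  then show ?thesis by blast
qed

lemma energy2_minimizer_exists:
  assumes "finite \<Gamma>"
  shows "\<exists>\<rho>. is_arg_min (energy2 E) (\<lambda>\<rho>. \<rho> \<in> Adm E \<Gamma> N) \<rho>"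
proof -
  obtain r where r: "r \<in> Adm E \<Gamma> N" using Adm_nonempty[OF assms] by blast
  define K where "K = energy2 E r"
  define B where "B = (\<lambda>e. if e \<in> E then {0..sqrt K} else {undefined})"
  define S where "S = Pi\<^sub>E UNIV B \<inter> (\<Inter>\<gamma>\<in>\<Gamma>. {\<rho>. 1 \<le> usage_mult E N \<rho> \<gamma>})"
  have "compact (Pi\<^sub>E UNIV B)"
    using compactin_PiE[of "\<lambda>_::'e. euclidean :: real topology" UNIV B]
    by (simp add: euclidean_product_topology B_def)
  moreover have "closed (\<Inter>\<gamma>\<in>\<Gamma>. {\<rho>. 1 \<le> usage_mult E N \<rho> \<gamma>})"
    unfolding usage_mult_def
    by (intro closed_INT ballI closed_Collect_le continuous_intros
        continuous_on_product_coordinates)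
  ultimately have S: "compact S" unfolding S_def by (rule compact_Int_closed)
  have small: "\<rho> \<in> S" if a: "\<rho> \<in> Adm E \<Gamma> N" and le: "energy2 E \<rho> \<le> K" for \<rho>
  proof -
    have "\<rho> e \<le> sqrt K" if e: "e \<in> E" for e
    proof -
      have "(\<rho> e)\<^sup>2 \<le> energy2 E \<rho>"
        unfolding energy2_def
        by (rule member_le_sum[OF e, where f = "\<lambda>e. (\<rho> e)\<^sup>2"]) (auto simp: finite_E)
      then show ?thesis using le by (intro real_le_rsqrt) simp
    qed
    then show ?thesis using a by (auto simp: S_def B_def Adm_def PiE_iff extensional_def)
  qed
  have S_Adm: "\<rho> \<in> Adm E \<Gamma> N" if "\<rho> \<in> S" for \<rho>
  proof -
    have "\<rho> e \<in> B e" for e using that by (auto simp: S_def)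
    then show ?thesis
      using that unfolding B_def
      by (auto simp: S_def Adm_def PiE_iff extensional_def split: if_splits)
        (metis atLeastAtMost_iff singletonD)+
  qed
  have rS: "r \<in> S" using small[OF r] by (simp add: K_def)
  have "continuous_on S (energy2 E)"
    unfolding energy2_def
    by (intro continuous_intros continuous_on_product_coordinates
        continuous_on_subset[OF continuous_on_product_coordinates]) auto
  then obtain s where s: "s \<in> S" "\<And>\<rho>. \<rho> \<in> S \<Longrightarrow> energy2 E s \<le> energy2 E \<rho>"
    using continuous_attains_inf[OF S] rS by blast
  have "energy2 E s \<le> energy2 E \<rho>" if "\<rho> \<in> Adm E \<Gamma> N" for \<rho>
    using s(2)[OF small[OF that]] s(2)[OF rS] by (force simp: K_def)
  then show ?thesis
    using S_Adm[OF s(1)] by (auto simp: is_arg_min_def not_less)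
qed

lemma energy2_minimizer_unique:
  assumes a: "is_arg_min (energy2 E) (\<lambda>\<rho>. \<rho> \<in> Adm E \<Gamma> N) a"
    and b: "is_arg_min (energy2 E) (\<lambda>\<rho>. \<rho> \<in> Adm E \<Gamma> N) b"
  shows "a = b"
proof -
  have aA: "a \<in> Adm E \<Gamma> N" and bA: "b \<in> Adm E \<Gamma> N"
    using a b by (auto simp: is_arg_min_def)
  define m where "m = (\<lambda>e\<in>E. (a e + b e) / 2)"
  have um: "usage_mult E N m \<gamma> = (usage_mult E N a \<gamma> + usage_mult E N b \<gamma>) / 2" for \<gamma>
    by (simp add: usage_mult_def m_def sum.distrib[symmetric] sum_divide_distrib distrib_left)
  have mA: "m \<in> Adm E \<Gamma> N"
    unfolding Adm_def
  proof (intro CollectI conjI ballI)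
    show "m \<in> E \<rightarrow>\<^sub>E {0..}" using aA bA by (auto simp: m_def Adm_def PiE_iff)
    show "1 \<le> usage_mult E N m \<gamma>" if "\<gamma> \<in> \<Gamma>" for \<gamma>
    proof -
      have "1 \<le> usage_mult E N a \<gamma>" "1 \<le> usage_mult E N b \<gamma>"
        using aA bA that by (auto simp: Adm_def)
      then show ?thesis by (simp add: um)
    qed
  qed
  have "energy2 E a \<le> energy2 E m" "energy2 E b \<le> energy2 E m"
    using a b mA by (auto simp: is_arg_min_def not_less)
  moreover have "energy2 E a + energy2 E b = 2 * energy2 E m + (\<Sum>e\<in>E. (a e - b e)\<^sup>2 / 2)"
    unfolding energy2_def sum_distrib_left sum.distrib[symmetric]
    by (rule sum.cong) (auto simp: m_def power2_eq_square field_simps)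
  ultimately have "(\<Sum>e\<in>E. (a e - b e)\<^sup>2 / 2) \<le> 0" by linarith
  then have "(\<Sum>e\<in>E. (a e - b e)\<^sup>2 / 2) = 0" by (intro antisym sum_nonneg) auto
  then have "\<forall>e\<in>E. a e = b e" by (simp add: sum_nonneg_eq_0_iff finite_E)
  then show ?thesis using aA bA by (intro PiE_ext[of a E "\<lambda>_. {0..}"]) (auto simp: Adm_def)
qed

lemma extremal_density_is_arg_min:
  assumes "finite \<Gamma>"
  shows "is_arg_min (energy2 E) (\<lambda>\<rho>. \<rho> \<in> Adm E \<Gamma> N) (extremal_density E \<Gamma> N)"
proof -
  have "\<exists>!\<rho>. is_arg_min (energy2 E) (\<lambda>\<rho>. \<rho> \<in> Adm E \<Gamma> N) \<rho>"
    using energy2_minimizer_exists[OF assms] energy2_minimizer_unique by blast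
  from theI'[OF this] show ?thesis by (simp add: extremal_density_def)
qed

end

end

theory Submission
  imports Defs
begin

text \<open>
  Write \<open>\<eta> = N\<^sup>T \<mu>\<close> for a mass function \<open>\<mu>\<close> minimizing \<open>q = \<mu>\<^sup>T N N\<^sup>T \<mu> = \<parallel>\<eta>\<parallel>\<^sup>2\<close>.  The point \<open>\<eta>\<close> is
  the point closest to the origin in the convex hull of the rows of \<open>N\<close>, so every row makes with
  \<open>\<eta>\<close> an inner product of at least \<open>q\<close> (\<open>optimal_pmf_variational\<close>).  This says exactly that
  \<open>\<rho> = \<eta> / q\<close> is admissible; its energy is \<open>1 / q\<close>.

  Conversely, averaging the constraints that define admissibility against \<open>\<mu>\<close> gives
  \<open>\<langle>\<eta>, \<rho>'\<rangle> \<ge> 1\<close> for every admissible \<open>\<rho>'\<close> (\<open>one_le_inner_usage_transpose\<close>).  Then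
  \<open>\<parallel>\<rho>'\<parallel>\<^sup>2 \<ge> \<parallel>\<rho>'\<parallel>\<^sup>2 - \<parallel>\<rho>' - \<eta> / q\<parallel>\<^sup>2 = 2 \<langle>\<eta>, \<rho>'\<rangle> / q - 1 / q \<ge> 1 / q\<close>, so \<open>\<eta> / q\<close> has least energy.
  By uniqueness it is the extremal density, and the modulus is \<open>1 / q\<close>; both claims follow, once an
  optimal \<open>\<mu>\<close> is known to exist, which is compactness of the simplex.
\<close>

lemma sum_usage_mult_adjoint:
  "(\<Sum>\<gamma>\<in>\<Gamma>. \<mu> \<gamma> * usage_mult E N \<rho> \<gamma>) = (\<Sum>e\<in>E. usage_transpose_mult \<Gamma> N \<mu> e * \<rho> e)"
  unfolding usage_mult_def usage_transpose_mult_def sum_distrib_left sum_distrib_right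
  by (subst sum.swap) (simp add: mult_ac)

lemma overlap_form_eq_energy2:
  "overlap_form E \<Gamma> N \<mu> = energy2 E (usage_transpose_mult \<Gamma> N \<mu>)"
  by (simp add: overlap_form_def sum_usage_mult_adjoint energy2_def power2_eq_square)

lemma optimal_pmf_exists:
  assumes fin: "finite \<Gamma>" and ne: "\<Gamma> \<noteq> {}"
  shows "\<exists>\<mu>. optimal_pmf E \<Gamma> N \<mu>"
proof -
  \<comment> \<open>Extensionality pins a mass function to \<open>undefined\<close> off \<open>\<Gamma>\<close>, so the simplex is a closed part
      of a product of compact sets in the product topology on all functions.\<close>
  define B :: "'a \<Rightarrow> real set" where "B = (\<lambda>\<gamma>. if \<gamma> \<in> \<Gamma> then {0..1} else {undefined})"
  define S where "S = Pi\<^sub>E UNIV B \<inter> {\<mu>. (\<Sum>\<gamma>\<in>\<Gamma>. \<mu> \<gamma>) = 1}"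
  have "compact (Pi\<^sub>E UNIV B)"
    using compactin_PiE[of "\<lambda>_::'a. euclidean :: real topology" UNIV B]
    by (simp add: euclidean_product_topology B_def)
  moreover have "closed {\<mu> :: 'a \<Rightarrow> real. (\<Sum>\<gamma>\<in>\<Gamma>. \<mu> \<gamma>) = 1}"
    by (intro closed_Collect_eq continuous_intros continuous_on_product_coordinates)
  ultimately have compact: "compact S" unfolding S_def by (rule compact_Int_closed)
  have le1: "\<mu> \<gamma> \<le> 1" if "\<mu> \<in> prob_mass_functions \<Gamma>" "\<gamma> \<in> \<Gamma>" for \<mu> \<gamma>
    using member_le_sum[OF that(2), of \<mu>] that(1) fin
    by (auto simp: prob_mass_functions_def PiE_iff)
  have S_eq: "S = prob_mass_functions \<Gamma>"
  proof (intro equalityI subsetI)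
    fix \<mu> assume m: "\<mu> \<in> S"
    then have "\<mu> \<gamma> \<in> B \<gamma>" for \<gamma> by (auto simp: S_def)
    then have "\<gamma> \<in> \<Gamma> \<Longrightarrow> 0 \<le> \<mu> \<gamma>" "\<gamma> \<notin> \<Gamma> \<Longrightarrow> \<mu> \<gamma> = undefined" for \<gamma>
      unfolding B_def by (metis atLeastAtMost_iff, metis singletonD)
    then show "\<mu> \<in> prob_mass_functions \<Gamma>"
      using m by (auto simp: S_def prob_mass_functions_def PiE_iff extensional_def)
  next
    fix \<mu> assume "\<mu> \<in> prob_mass_functions \<Gamma>"
    then show "\<mu> \<in> S"
      using le1 by (auto simp: S_def B_def prob_mass_functions_def PiE_iff extensional_def)
  qed
  have "(\<lambda>\<gamma>\<in>\<Gamma>. inverse (real (card \<Gamma>))) \<in> S"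
    using fin ne by (auto simp: S_eq prob_mass_functions_def)
  moreover have "continuous_on S (overlap_form E \<Gamma> N)"
    unfolding overlap_form_def usage_mult_def usage_transpose_mult_def
    by (intro continuous_intros continuous_on_product_coordinates
        continuous_on_subset[OF continuous_on_product_coordinates]) auto
  ultimately obtain \<mu> where "\<mu> \<in> S" "\<And>\<nu>. \<nu> \<in> S \<Longrightarrow> overlap_form E \<Gamma> N \<mu> \<le> overlap_form E \<Gamma> N \<nu>"
    using continuous_attains_inf[OF compact] by blast
  then show ?thesis
    by (auto simp: S_eq optimal_pmf_def is_arg_min_def not_less)
qed

lemma nonneg_of_quadratic_nonneg_near_0:
  fixes a b :: real
  assumes b: "0 \<le> b" and nn: "\<And>t. 0 < t \<Longrightarrow> t \<le> 1 \<Longrightarrow> 0 \<le> 2 * t * a + t\<^sup>2 * b"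
  shows "0 \<le> a"
proof (rule ccontr)
  assume "\<not> 0 \<le> a"
  then have a: "a < 0" by simp
  \<comment> \<open>This \<open>t\<close> lies in \<open>(0, 1]\<close> and satisfies \<open>t * b \<le> - a\<close>, so the linear term dominates.\<close>
  define t where "t = - a / (b - a)"
  have t: "0 < t" "t \<le> 1" using a b by (auto simp: t_def field_simps)
  have "t * (b - a) = - a" using a b by (simp add: t_def)
  then have "t * b = - a + t * a" by (simp add: algebra_simps)
  moreover have "t * a < 0" using t a by (simp add: mult_pos_neg)
  ultimately have "2 * a + t * b < 0" using a by linarith
  then have "t * (2 * a + t * b) < 0" using t by (simp add: mult_pos_neg)
  then show False using nn[OF t] by (simp add: algebra_simps power2_eq_square)
qed

text \<open>
  The first-order optimality condition, from the segment that joins \<open>\<mu>\<close> to the point mass at \<open>\<gamma>\<close>.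
\<close>

lemma optimal_pmf_variational:
  assumes fin: "finite \<Gamma>" and opt: "optimal_pmf E \<Gamma> N \<mu>" and g: "\<gamma> \<in> \<Gamma>"
  shows "overlap_form E \<Gamma> N \<mu> \<le> usage_mult E N (usage_transpose_mult \<Gamma> N \<mu>) \<gamma>"
proof -
  define \<eta> where "\<eta> = usage_transpose_mult \<Gamma> N \<mu>"
  have \<mu>: "\<mu> \<in> prob_mass_functions \<Gamma>" using opt by (simp add: optimal_pmf_def is_arg_min_def)
  define a where "a = (\<Sum>e\<in>E. \<eta> e * (N \<gamma> e - \<eta> e))"
  define b where "b = (\<Sum>e\<in>E. (N \<gamma> e - \<eta> e)\<^sup>2)"
  have "0 \<le> 2 * t * a + t\<^sup>2 * b" if t: "0 < t" "t \<le> 1" for t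
  proof -
    define \<nu> where "\<nu> = (\<lambda>\<delta>\<in>\<Gamma>. (1 - t) * \<mu> \<delta> + t * (if \<delta> = \<gamma> then 1 else 0))"
    have "(\<Sum>\<delta>\<in>\<Gamma>. \<nu> \<delta>) = (1 - t) * (\<Sum>\<delta>\<in>\<Gamma>. \<mu> \<delta>) + t"
      using g fin by (simp add: \<nu>_def sum.distrib sum_distrib_left[symmetric])
    then have "\<nu> \<in> prob_mass_functions \<Gamma>"
      using \<mu> t by (auto simp: prob_mass_functions_def PiE_iff \<nu>_def)
    then have le: "overlap_form E \<Gamma> N \<mu> \<le> overlap_form E \<Gamma> N \<nu>"
      using opt by (auto simp: optimal_pmf_def is_arg_min_def not_less)
    have N\<nu>: "usage_transpose_mult \<Gamma> N \<nu> e = \<eta> e + t * (N \<gamma> e - \<eta> e)" for e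
    proof -
      have "usage_transpose_mult \<Gamma> N \<nu> e
          = (\<Sum>\<delta>\<in>\<Gamma>. (1 - t) * (N \<delta> e * \<mu> \<delta>) + t * (if \<delta> = \<gamma> then N \<delta> e else 0))"
        unfolding usage_transpose_mult_def by (rule sum.cong) (auto simp: \<nu>_def algebra_simps)
      also have "\<dots> = (1 - t) * \<eta> e + t * N \<gamma> e"
        using g fin
        by (simp add: sum.distrib sum_distrib_left[symmetric] \<eta>_def usage_transpose_mult_def)
      finally show ?thesis by (simp add: algebra_simps)
    qed
    have "overlap_form E \<Gamma> N \<nu> = overlap_form E \<Gamma> N \<mu> + (2 * t * a + t\<^sup>2 * b)"
      unfolding overlap_form_eq_energy2 energy2_def N\<nu> \<eta>_def[symmetric] a_def b_def
        sum_distrib_left sum.distrib[symmetric]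
      by (rule sum.cong) (auto simp: power2_eq_square algebra_simps)
    with le show ?thesis by linarith
  qed
  then have "0 \<le> a"
    by (rule nonneg_of_quadratic_nonneg_near_0[rotated]) (auto simp: b_def intro: sum_nonneg)
  moreover have "a = usage_mult E N \<eta> \<gamma> - overlap_form E \<Gamma> N \<mu>"
    by (simp add: a_def usage_mult_def overlap_form_eq_energy2 energy2_def \<eta>_def[symmetric]
        sum_subtractf[symmetric] power2_eq_square algebra_simps)
  ultimately show ?thesis by (simp add: \<eta>_def)
qed

lemma one_le_inner_usage_transpose:
  assumes \<mu>: "\<mu> \<in> prob_mass_functions \<Gamma>" and \<rho>: "\<rho> \<in> Adm E \<Gamma> N"
  shows "1 \<le> (\<Sum>e\<in>E. usage_transpose_mult \<Gamma> N \<mu> e * \<rho> e)"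
proof -
  have "(\<Sum>\<gamma>\<in>\<Gamma>. \<mu> \<gamma> * 1) \<le> (\<Sum>\<gamma>\<in>\<Gamma>. \<mu> \<gamma> * usage_mult E N \<rho> \<gamma>)"
    using assms by (intro sum_mono mult_left_mono) (auto simp: Adm_def prob_mass_functions_def)
  then show ?thesis using \<mu> by (simp add: sum_usage_mult_adjoint prob_mass_functions_def)
qed

context object_family
begin

lemma usage_transpose_mult_nonneg:
  assumes "\<mu> \<in> prob_mass_functions \<Gamma>" "e \<in> E"
  shows "0 \<le> usage_transpose_mult \<Gamma> N \<mu> e"
  unfolding usage_transpose_mult_def using assms usage_nonneg
  by (intro sum_nonneg mult_nonneg_nonneg) (auto simp: prob_mass_functions_def)

text \<open>
  Positivity rests on every object using some edge: an object of positive mass makes \<open>N\<^sup>T \<mu>\<close>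
  positive on an edge that it uses, since nonnegative entries cannot cancel.
\<close>

lemma overlap_form_pos:
  assumes fin: "finite \<Gamma>" and \<mu>: "\<mu> \<in> prob_mass_functions \<Gamma>"
  shows "0 < overlap_form E \<Gamma> N \<mu>"
proof -
  have nn: "0 \<le> \<mu> \<gamma>" if "\<gamma> \<in> \<Gamma>" for \<gamma> using \<mu> that by (auto simp: prob_mass_functions_def)
  have "(\<Sum>\<gamma>\<in>\<Gamma>. \<mu> \<gamma>) \<noteq> 0" using \<mu> by (simp add: prob_mass_functions_def)
  then obtain \<gamma> where g: "\<gamma> \<in> \<Gamma>" "\<mu> \<gamma> \<noteq> 0" by (meson sum.neutral)
  then have mpos: "0 < \<mu> \<gamma>" using nn[OF g(1)] by simp
  obtain e where e: "e \<in> E" "0 < N \<gamma> e" using usage_pos[OF g(1)] by blast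
  have "0 < usage_transpose_mult \<Gamma> N \<mu> e"
    unfolding usage_transpose_mult_def
    by (rule sum_pos2[OF fin g(1)]) (use e mpos nn usage_nonneg in auto)
  then show ?thesis
    unfolding overlap_form_eq_energy2 energy2_def
    by (intro sum_pos2[OF finite_E e(1)]) auto
qed

text \<open>
  Weak duality between the two minimizations is the lower bound on the energy, proved by expanding
  \<open>\<parallel>\<rho> - \<eta> / q\<parallel>\<^sup>2 \<ge> 0\<close>; the variational inequality supplies the matching admissible density.
\<close>

lemma optimal_pmf_is_arg_min_energy2:
  assumes fin: "finite \<Gamma>" and opt: "optimal_pmf E \<Gamma> N \<mu>"
  defines "q \<equiv> overlap_form E \<Gamma> N \<mu>"
  defines "\<rho>0 \<equiv> (\<lambda>e\<in>E. usage_transpose_mult \<Gamma> N \<mu> e / q)"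
  shows "is_arg_min (energy2 E) (\<lambda>\<rho>. \<rho> \<in> Adm E \<Gamma> N) \<rho>0" and "energy2 E \<rho>0 = inverse q"
proof -
  define \<eta> where "\<eta> = usage_transpose_mult \<Gamma> N \<mu>"
  have \<mu>: "\<mu> \<in> prob_mass_functions \<Gamma>" using opt by (simp add: optimal_pmf_def is_arg_min_def)
  have q0: "0 < q" unfolding q_def by (rule overlap_form_pos[OF fin \<mu>])
  have q: "q = (\<Sum>e\<in>E. (\<eta> e)\<^sup>2)" by (simp add: q_def overlap_form_eq_energy2 energy2_def \<eta>_def)
  have "energy2 E \<rho>0 = q / q\<^sup>2"
    by (simp add: energy2_def \<rho>0_def \<eta>_def[symmetric] power_divide sum_divide_distrib[symmetric] q)
  then show en: "energy2 E \<rho>0 = inverse q" using q0 by (simp add: power2_eq_square field_simps)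
  have adm: "\<rho>0 \<in> Adm E \<Gamma> N"
  proof -
    have "1 \<le> usage_mult E N \<rho>0 \<gamma>" if g: "\<gamma> \<in> \<Gamma>" for \<gamma>
    proof -
      have "usage_mult E N \<rho>0 \<gamma> = usage_mult E N \<eta> \<gamma> / q"
        by (simp add: usage_mult_def \<rho>0_def \<eta>_def sum_divide_distrib)
      then show ?thesis
        using optimal_pmf_variational[OF fin opt g] q0 by (simp add: q_def \<eta>_def)
    qed
    moreover have "\<rho>0 \<in> E \<rightarrow>\<^sub>E {0..}"
      using usage_transpose_mult_nonneg[OF \<mu>] q0 by (auto simp: \<rho>0_def)
    ultimately show ?thesis by (simp add: Adm_def)
  qed
  have "inverse q \<le> energy2 E \<rho>" if \<rho>: "\<rho> \<in> Adm E \<Gamma> N" for \<rho>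
  proof -
    define c where "c = inverse q"
    have c: "0 < c" "c * q = 1" using q0 by (auto simp: c_def)
    have "0 \<le> (\<Sum>e\<in>E. (\<rho> e - c * \<eta> e)\<^sup>2)" by (intro sum_nonneg) auto
    also have "\<dots> = energy2 E \<rho> - 2 * c * (\<Sum>e\<in>E. \<eta> e * \<rho> e) + c * (c * q)"
      unfolding energy2_def q sum_distrib_left sum.distrib[symmetric] sum_subtractf[symmetric]
      by (rule sum.cong) (auto simp: power2_eq_square algebra_simps)
    finally have "2 * c * (\<Sum>e\<in>E. \<eta> e * \<rho> e) \<le> energy2 E \<rho> + c" by (simp add: c)
    moreover have "2 * c * 1 \<le> 2 * c * (\<Sum>e\<in>E. \<eta> e * \<rho> e)"
      using one_le_inner_usage_transpose[OF \<mu> \<rho>] c by (intro mult_left_mono) (auto simp: \<eta>_def)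
    ultimately show ?thesis by (simp add: c_def)
  qed
  then show "is_arg_min (energy2 E) (\<lambda>\<rho>. \<rho> \<in> Adm E \<Gamma> N) \<rho>0"
    using adm en by (auto simp: is_arg_min_def not_less)
qed

lemma Mod2_eq_energy2_of_arg_min:
  assumes "is_arg_min (energy2 E) (\<lambda>\<rho>. \<rho> \<in> Adm E \<Gamma> N) \<rho>"
  shows "Mod2 E \<Gamma> N = energy2 E \<rho>"
  unfolding Mod2_def using assms
  by (intro cInf_eq_minimum) (auto simp: is_arg_min_def not_less)

lemma Mod2_eq_inverse_overlap_form:
  assumes "finite \<Gamma>" "optimal_pmf E \<Gamma> N \<mu>"
  shows "Mod2 E \<Gamma> N = inverse (overlap_form E \<Gamma> N \<mu>)"
  using optimal_pmf_is_arg_min_energy2[OF assms] by (simp add: Mod2_eq_energy2_of_arg_min)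

lemma extremal_density_eq:
  assumes "finite \<Gamma>" "optimal_pmf E \<Gamma> N \<mu>"
  shows "extremal_density E \<Gamma> N = (\<lambda>e\<in>E. usage_transpose_mult \<Gamma> N \<mu> e / overlap_form E \<Gamma> N \<mu>)"
  by (rule energy2_minimizer_unique[OF extremal_density_is_arg_min[OF assms(1)]
        optimal_pmf_is_arg_min_energy2(1)[OF assms]])

end

theorem theorem5p1:
  fixes V :: "'v set" and E :: "'e set" and ends :: "'e \<Rightarrow> 'v set"
    and \<Gamma> :: "'g set" and N :: "'g \<Rightarrow> 'e \<Rightarrow> real"
  assumes "object_family V E ends \<Gamma> N"
    and "finite \<Gamma>"
    and "\<Gamma> \<noteq> {}"
  shows "(\<exists>\<mu>. optimal_pmf E \<Gamma> N \<mu> \<and> 0 < overlap_form E \<Gamma> N \<mu> \<and>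
              Mod2 E \<Gamma> N = inverse (overlap_form E \<Gamma> N \<mu>)) \<and>
         (\<forall>\<mu>. optimal_pmf E \<Gamma> N \<mu> \<longrightarrow>
              (\<forall>e\<in>E. extremal_density E \<Gamma> N e / Mod2 E \<Gamma> N = usage_transpose_mult \<Gamma> N \<mu> e))"
proof -
  interpret object_family V E ends \<Gamma> N by (fact assms(1))
  have pos: "0 < overlap_form E \<Gamma> N \<mu>" if "optimal_pmf E \<Gamma> N \<mu>" for \<mu>
    using that by (intro overlap_form_pos assms(2)) (simp add: optimal_pmf_def is_arg_min_def)
  have "extremal_density E \<Gamma> N e / Mod2 E \<Gamma> N = usage_transpose_mult \<Gamma> N \<mu> e"
    if "optimal_pmf E \<Gamma> N \<mu>" "e \<in> E" for \<mu> e
    using pos[OF that(1)] that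
    by (simp add: extremal_density_eq[OF assms(2) that(1)]
        Mod2_eq_inverse_overlap_form[OF assms(2) that(1)])
  moreover obtain \<mu> where "optimal_pmf E \<Gamma> N \<mu>"
    using optimal_pmf_exists[OF assms(2,3)] by blast
  ultimately show ?thesis
    using pos Mod2_eq_inverse_overlap_form[OF assms(2)] by blast
qed

end
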